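(* For $n\ge2$ consider the problem $$\min_{\bm O_t\in\Omega_O^{(n)}}\ \Big\|\underset{\bm\pi_{s\ge t}\in\Omega_\pi^{(O)}}{\arg\max}\ \mathbb E(U(W_T)\mid\mathcal F_t)\Big\|_1,\qquad (P_n)$$ that is, minimize $\|\bm\pi_t\|_1=\sum_{i=1}^n|\pi_t^{(i)}|$ over all pairs $(\bm O_t,\bm\pi_t)$ with $\bm O_t\in\Omega_O^{(n)}$ and $\bm\pi_t$ an expected-utility-maximizing allocation for $\bm O_t$. Assume that an optimal solution of $(P_n)$ exists for $n\ge2$. Then $(P_n)$ leads to the same minimal $\ell_1$ norm for any $n\ge2$. In addition, there exists an optimal strategy for $(P_n)$ for which the number of non-zero allocations is less than or equal to $2$.
   Context: Market: a money market account $dM_t=rM_tdt$ and two assets $dS_t^{(j)}=S_t^{(j)}[(r+\sigma^{(j)}\lambda^{(j)})dt+\sigma^{(j)}dB_t^{(j)}]$, $j=1,2$, on a filtered probability space, with constants $r$, $\sigma^{(j)}>0$, $\bm\Lambda=[\lambda^{(1)},\lambda^{(2)}]^T$, and Brownian motions $B^{(1)},B^{(2)}$ with correlation $\rho\in(-1,1)$. Put $\bm\Phi=\begin{bmatrix}1&0\\ \rho&\sqrt{1-\rho^2}\end{bmatrix}$. The investor has utility $U(w)=\frac{w^{1-\gamma}}{1-\gamma}$, $\gamma>0$, $\gamma\neq1$. Derivatives: there is a fixed infinite universe of derivatives on $(S^{(1)},S^{(2)})$ available to the investor. $\Omega_O^{(n)}$ is the set of vectors $\bm O_t=[O_t^{(1)},\dots,O_t^{(n)}]^T$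 of available derivatives with $O_t^{(i)}\ne0$ for all $i$ and such that the $n\times 2$ variance matrix $\bm\Sigma_t=(f_t^{ij})$, $f_t^{ij}=\frac{\partial O_t^{(i)}}{\partial S_t^{(j)}}\frac{S_t^{(j)}\sigma^{(j)}}{O_t^{(i)}}$, has rank $2$, for $t\in[0,T]$. Strategies: $\Omega_\pi^{(O)}$ is the set of admissible strategies $\bm\pi$, with $\pi_t^{(i)}$ the proportion of wealth in $O_t^{(i)}$ and the rest in $M_t$; wealth satisfies $\frac{dW_t}{W_t}=(r+\bm\pi_t^T\bm\Sigma_t\bm\Lambda)dt+\bm\pi_t^T\bm\Sigma_td\bm B_t$. Expected-utility-maximizing allocations: for $\bm O_t\in\Omega_O^{(n)}$, $\bm\pi_t\in\mathbb R^n$ is an expected-utility-maximizing allocation at time $t$ if and only if $\bm\Sigma_t^T\bm\pi_t=\bm\eta_t^*$, where $\bm\eta_t^*=\frac{(\bm\Phi\bm\Phi^T)^{-1}\bm\Lambda}{\gamma}\in\mathbb R^2$. The problem is posed at a fixed time $t$ (and market state), and the minimum is also taken over the non-unique argmax when $n>2$. *)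

theory Defs
  imports
    "HOL-Analysis.Derivative"
    "Jordan_Normal_Form.DL_Rank"
    "Jordan_Normal_Form.Gauss_Jordan_Elimination"
begin

record market =
  rate :: real
  vol1 :: real
  vol2 :: real
  price_of_risk1 :: real
  price_of_risk2 :: real
  corr :: real
  risk_aversion :: real

text \<open>A derivative is given by its pricing function: time, price of the first asset, price of the
  second asset.\<close>

type_synonym claim = "real \<Rightarrow> real \<Rightarrow> real \<Rightarrow> real"

definition has_partials :: "claim \<Rightarrow> real \<Rightarrow> real \<Rightarrow> real \<Rightarrow> bool" where
  "has_partials F t s1 s2 \<longleftrightarrow>
     (\<lambda>x. F t x s2) differentiable at s1 \<and> (\<lambda>x. F t s1 x) differentiable at s2"

definition variance_matrix :: "market \<Rightarrow> real \<Rightarrow> real \<Rightarrow> real \<Rightarrow> claim list \<Rightarrow> real mat" where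
  "variance_matrix m t s1 s2 Os = mat_of_rows_list 2
     (map (\<lambda>F. [deriv (\<lambda>x. F t x s2) s1 * (s1 * vol1 m / F t s1 s2),
                deriv (\<lambda>x. F t s1 x) s2 * (s2 * vol2 m / F t s1 s2)]) Os)"

text \<open>Entries of the vector need not be distinct. Existence of the partial derivatives at the
  current state is required so that \<^const>\<open>deriv\<close> never takes an unspecified value.\<close>

definition derivative_vectors ::
    "market \<Rightarrow> claim set \<Rightarrow> real \<Rightarrow> real \<Rightarrow> real \<Rightarrow> nat \<Rightarrow> claim list set" where
  "derivative_vectors m \<D> t s1 s2 n =
     {Os. length Os = n \<and> set Os \<subseteq> \<D> \<and>
          (\<forall>F\<in>set Os. has_partials F t s1 s2 \<and> F t s1 s2 \<noteq> 0) \<and>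
          vec_space.rank n (variance_matrix m t s1 s2 Os) = 2}"

definition corr_factor :: "market \<Rightarrow> real mat" where
  "corr_factor m = mat_of_rows_list 2 [[1, 0], [corr m, sqrt (1 - (corr m)\<^sup>2)]]"

definition optimal_exposure :: "market \<Rightarrow> real vec" where
  "optimal_exposure m =
     (1 / risk_aversion m) \<cdot>\<^sub>v
       (the (mat_inverse (corr_factor m * transpose_mat (corr_factor m))) *\<^sub>v
        vec_of_list [price_of_risk1 m, price_of_risk2 m])"

text \<open>The allocations at time \<open>t\<close> of the strategies maximizing conditional expected power utility
  of terminal wealth are taken to be those that produce the exposure
  \<^const>\<open>optimal_exposure\<close>; the stochastic control problem itself is not modelled.\<close>

definition eu_maximizing ::
    "market \<Rightarrow> real \<Rightarrow> real \<Rightarrow> real \<Rightarrow> claim list \<Rightarrow> real vec \<Rightarrow> bool" where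
  "eu_maximizing m t s1 s2 Os \<pi> \<longleftrightarrow>
     \<pi> \<in> carrier_vec (length Os) \<and>
     transpose_mat (variance_matrix m t s1 s2 Os) *\<^sub>v \<pi> = optimal_exposure m"

definition l1_norm :: "real vec \<Rightarrow> real" where
  "l1_norm v = (\<Sum>i<dim_vec v. \<bar>vec_index v i\<bar>)"

definition feasible ::
    "market \<Rightarrow> claim set \<Rightarrow> real \<Rightarrow> real \<Rightarrow> real \<Rightarrow> nat \<Rightarrow> claim list \<times> real vec \<Rightarrow> bool" where
  "feasible m \<D> t s1 s2 n = (\<lambda>(Os, \<pi>).
     Os \<in> derivative_vectors m \<D> t s1 s2 n \<and> eu_maximizing m t s1 s2 Os \<pi>)"

definition optimal ::
    "market \<Rightarrow> claim set \<Rightarrow> real \<Rightarrow> real \<Rightarrow> real \<Rightarrow> nat \<Rightarrow> claim list \<times> real vec \<Rightarrow> bool" where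
  "optimal m \<D> t s1 s2 n =
     is_arg_min (\<lambda>(Os, \<pi>). l1_norm \<pi>) (feasible m \<D> t s1 s2 n)"

end

theory Submission
  imports Defs
begin

no_notation vec_nth (infixl "$" 90)

text \<open>Feasibility says that the rows of the variance matrix span the plane and that the optimal
  exposure is their combination with weights \<open>\<pi>\<close>. As in linear programming, moving \<open>\<pi>\<close> along a
  linear dependence among the rows in its support, in the direction that does not increase the
  \<open>\<ell>\<^sub>1\<close> norm, kills a weight; what remains is carried by two linearly independent rows,
  which is a feasible point of the problem with two derivatives. Conversely a feasible point for two
  derivatives is padded by repeating a derivative with zero weight.\<close>

section \<open>Sparse representations in the plane\<close>

text \<open>Along \<open>w - s * c\<close> the weighted sum is constant, and as long as no
  coordinate changes sign the l1 norm is affine in \<open>s\<close>. Stopping when the first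
  coordinate reaches zero shrinks the support, because by \<open>supp\<close> no new index can enter
  it.\<close>

lemma support_reduction:
  fixes v :: "'i \<Rightarrow> 'a::real_vector" and w c :: "'i \<Rightarrow> real"
  assumes fin: "finite I"
    and supp: "\<And>i. i \<in> I \<Longrightarrow> w i = 0 \<Longrightarrow> c i = 0"
    and dep: "(\<Sum>i\<in>I. c i *\<^sub>R v i) = 0"
    and nz: "k \<in> I" "c k \<noteq> 0"
  shows "\<exists>w'. (\<Sum>i\<in>I. w' i *\<^sub>R v i) = (\<Sum>i\<in>I. w i *\<^sub>R v i) \<and>
    (\<Sum>i\<in>I. \<bar>w' i\<bar>) \<le> (\<Sum>i\<in>I. \<bar>w i\<bar>) \<and>
    {i \<in> I. w' i \<noteq> 0} \<subset> {i \<in> I. w i \<noteq> 0}"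
proof -
  \<comment> \<open>The sum in \<open>dir\<close> is the slope of the l1 norm at \<open>w\<close> in
    direction \<open>c\<close>. Its sign may be assumed, since \<open>- c\<close> is a dependence as
    well.\<close>
  have main: ?thesis
    if supp: "\<And>i. i \<in> I \<Longrightarrow> w i = 0 \<Longrightarrow> c i = 0"
      and dep: "(\<Sum>i\<in>I. c i *\<^sub>R v i) = 0"
      and nz: "c k \<noteq> 0"
      and dir: "0 \<le> (\<Sum>i\<in>I. sgn (w i) * c i)" for c
  proof -
    \<comment> \<open>These are the coordinates that move towards zero when a small positive
      multiple of \<open>c\<close> is subtracted.\<close>
    define P where "P = {i \<in> I. 0 < c i * w i}"
    \<comment> \<open>Otherwise no term of the sum in \<open>dir\<close> is positive, so all of them
      vanish; but the term at \<open>k\<close> does not, as \<open>c k \<noteq> 0\<close> forces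
      \<open>w k \<noteq> 0\<close>.\<close>
    have "P \<noteq> {}"
    proof
      assume "P = {}"
      then have le: "\<And>i. i \<in> I \<Longrightarrow> sgn (w i) * c i \<le> 0"
        by (force simp: P_def sgn_real_def mult_less_0_iff zero_less_mult_iff)
      then have "(\<Sum>i\<in>I. sgn (w i) * c i) = 0"
        using dir by (meson order_antisym sum_nonpos)
      then have "sgn (w k) * c k = 0"
        using le fin \<open>k \<in> I\<close>
          sum_nonneg_eq_0_iff[of I "\<lambda>i. - (sgn (w i) * c i)"] by (simp add: sum_negf)
      then show False
        using nz supp \<open>k \<in> I\<close> by (auto simp: sgn_zero_iff)
    qed
    \<comment> \<open>This is the ratio test of the simplex method: the largest step before some
      coordinate in \<open>P\<close> crosses zero. The index attaining the minimum leaves the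
      support.\<close>
    define s where "s = Min ((\<lambda>i. w i / c i) ` P)"
    have "finite P" using fin by (simp add: P_def)
    have "s \<in> (\<lambda>i. w i / c i) ` P"
      unfolding s_def using \<open>finite P\<close> \<open>P \<noteq> {}\<close> by (intro Min_in) auto
    then obtain j where j: "j \<in> P" "s = w j / c j" by blast
    have s_le: "s \<le> w i / c i" if "i \<in> P" for i
      using that \<open>finite P\<close> by (simp add: s_def)
    have "0 < s"
      using j by (auto simp: P_def zero_less_mult_iff zero_less_divide_iff)
    \<comment> \<open>No coordinate changes sign: inside \<open>P\<close> the step is bounded by the
      ratio, outside \<open>P\<close> a coordinate stays put or moves away from zero.\<close>
    have abs_eq: "\<bar>w i - s * c i\<bar> = \<bar>w i\<bar> - s * (sgn (w i) * c i)" if "i \<in> I" for i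
    proof (cases "i \<in> P")
      case True
      then show ?thesis
        using s_le[OF True]
        by (auto simp: P_def zero_less_mult_iff sgn_real_def field_simps abs_if)
    next
      case False
      then have "c i * w i \<le> 0"
        using that by (simp add: P_def)
      then consider "w i = 0" "c i = 0" | "0 < w i" "c i \<le> 0" | "w i < 0" "0 \<le> c i"
        using supp[OF \<open>i \<in> I\<close>] by (cases "w i" "0::real" rule: linorder_cases) (auto simp: mult_le_0_iff)
      then show ?thesis
      proof cases
        case 2
        then have "s * c i \<le> 0" using \<open>0 < s\<close> by (simp add: mult_le_0_iff)
        with 2 show ?thesis by simp
      next
        case 3
        then have "0 \<le> s * c i" using \<open>0 < s\<close> by simp
        with 3 show ?thesis by simp
      qed simp
    qed
    let ?w = "\<lambda>i. w i - s * c i"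
    have "(\<Sum>i\<in>I. ?w i *\<^sub>R v i) = (\<Sum>i\<in>I. w i *\<^sub>R v i) - s *\<^sub>R (\<Sum>i\<in>I. c i *\<^sub>R v i)"
      by (simp add: scaleR_diff_left sum_subtractf scaleR_right.sum)
    moreover have "(\<Sum>i\<in>I. \<bar>?w i\<bar>) = (\<Sum>i\<in>I. \<bar>w i\<bar>) - s * (\<Sum>i\<in>I. sgn (w i) * c i)"
      by (simp add: abs_eq sum_subtractf sum_distrib_left)
    moreover have "0 \<le> s * (\<Sum>i\<in>I. sgn (w i) * c i)"
      using \<open>0 < s\<close> dir by simp
    moreover have "j \<in> {i \<in> I. w i \<noteq> 0} - {i \<in> I. ?w i \<noteq> 0}"
      using j by (auto simp: P_def)
    then have "{i \<in> I. ?w i \<noteq> 0} \<subset> {i \<in> I. w i \<noteq> 0}"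
      using supp by auto
    ultimately show ?thesis
      using dep by (intro exI[of _ ?w]) auto
  qed
  show ?thesis
  proof (cases "0 \<le> (\<Sum>i\<in>I. sgn (w i) * c i)")
    case True
    then show ?thesis
      using main[of c] supp dep nz by blast
  next
    case False
    then show ?thesis
      using main[of "\<lambda>i. - c i"] supp dep nz by (simp add: sum_negf)
  qed
qed

text \<open>Repeated support reduction ends with a linearly independent support, which in the plane
  has at most two indices. A smaller support is completed with zero weights, which is where the
  spanning pair \<open>i0\<close>, \<open>j0\<close> enters.\<close>

lemma planar_basic_solution:
  fixes x y w :: "'i \<Rightarrow> real"
  assumes fin: "finite I"
    and span: "i0 \<in> I" "j0 \<in> I" "x i0 * y j0 \<noteq> x j0 * y i0"
  shows "\<exists>i\<in>I. \<exists>j\<in>I. \<exists>a b. x i * y j \<noteq> x j * y i \<and>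
    a * x i + b * x j = (\<Sum>i\<in>I. w i * x i) \<and> a * y i + b * y j = (\<Sum>i\<in>I. w i * y i) \<and>
    \<bar>a\<bar> + \<bar>b\<bar> \<le> (\<Sum>i\<in>I. \<bar>w i\<bar>)"
proof (induction "card {i \<in> I. w i \<noteq> 0}" arbitrary: w rule: less_induct)
  case less
  define S where "S = {i \<in> I. w i \<noteq> 0}"
  have "finite S" "S \<subseteq> I" using fin by (auto simp: S_def)
  have sum_S: "(\<Sum>i\<in>I. w i * f i) = (\<Sum>i\<in>S. w i * f i)" for f
    using fin by (intro sum.mono_neutral_right) (auto simp: S_def)
  have abs_S: "(\<Sum>i\<in>I. \<bar>w i\<bar>) = (\<Sum>i\<in>S. \<bar>w i\<bar>)"
    using fin by (intro sum.mono_neutral_right) (auto simp: S_def)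
  show ?case
  \<comment> \<open>The question is whether the vectors indexed by the support are dependent as a
    family, so equal vectors at different indices count as dependent.\<close>
  proof (cases "\<exists>c. (\<forall>i. i \<notin> S \<longrightarrow> c i = 0) \<and> (\<exists>k\<in>S. c k \<noteq> 0) \<and>
      (\<Sum>i\<in>S. c i * x i) = 0 \<and> (\<Sum>i\<in>S. c i * y i) = 0")
    case True
    then obtain c k where c: "\<And>i. i \<notin> S \<Longrightarrow> c i = 0" "k \<in> S" "c k \<noteq> 0"
      "(\<Sum>i\<in>S. c i * x i) = 0" "(\<Sum>i\<in>S. c i * y i) = 0" by blast
    have "(\<Sum>i\<in>I. c i * f i) = (\<Sum>i\<in>S. c i * f i)" for f
      using fin c(1) \<open>S \<subseteq> I\<close> by (intro sum.mono_neutral_right) auto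
    then have "(\<Sum>i\<in>I. c i *\<^sub>R (x i, y i)) = 0"
      using c by (simp add: prod_eq_iff fst_sum snd_sum)
    then obtain w' where w': "(\<Sum>i\<in>I. w' i *\<^sub>R (x i, y i)) = (\<Sum>i\<in>I. w i *\<^sub>R (x i, y i))"
      "(\<Sum>i\<in>I. \<bar>w' i\<bar>) \<le> (\<Sum>i\<in>I. \<bar>w i\<bar>)" "{i \<in> I. w' i \<noteq> 0} \<subset> {i \<in> I. w i \<noteq> 0}"
      using support_reduction[OF fin, of w c "\<lambda>i. (x i, y i)" k] c \<open>S \<subseteq> I\<close>
      by (auto simp: S_def)
    have "card {i \<in> I. w' i \<noteq> 0} < card {i \<in> I. w i \<noteq> 0}"
      using w'(3) fin by (intro psubset_card_mono) auto
    moreover have "(\<Sum>i\<in>I. w' i * x i) = (\<Sum>i\<in>I. w i * x i)"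
      "(\<Sum>i\<in>I. w' i * y i) = (\<Sum>i\<in>I. w i * y i)"
      using w'(1) by (simp_all add: prod_eq_iff fst_sum snd_sum)
    ultimately show ?thesis
      using less[of w'] w'(2) by (smt (verit, best))
  next
    case False
    then have indep: "\<And>c k. (\<And>i. i \<notin> S \<Longrightarrow> c i = 0) \<Longrightarrow> k \<in> S \<Longrightarrow>
      (\<Sum>i\<in>S. c i * x i) = 0 \<Longrightarrow> (\<Sum>i\<in>S. c i * y i) = 0 \<Longrightarrow> c k = 0"
      by blast
    \<comment> \<open>Extending coefficients from \<open>A\<close> to \<open>S\<close> by zero lets
      \<open>indep_on\<close> pass independence to subfamilies.\<close>
    have sum_sub: "(\<Sum>k\<in>S. (if k \<in> A then g k else 0) * f k) = (\<Sum>k\<in>A. g k * f k)"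
      if "A \<subseteq> S" for A and f g :: "'i \<Rightarrow> real"
    proof -
      have "(\<Sum>k\<in>S. (if k \<in> A then g k else 0) * f k)
          = (\<Sum>k\<in>A. (if k \<in> A then g k else 0) * f k)"
        using \<open>finite S\<close> that by (intro sum.mono_neutral_right) auto
      then show ?thesis by simp
    qed
    have indep_on: "g k = 0" if "A \<subseteq> S" "k \<in> A" "(\<Sum>i\<in>A. g i * x i) = 0" "(\<Sum>i\<in>A. g i * y i) = 0"
      for A k and g :: "'i \<Rightarrow> real"
    proof -
      have "(if k \<in> A then g k else 0) = 0"
        by (rule indep) (use that in \<open>auto simp: sum_sub[OF that(1)]\<close>)
      then show ?thesis using that by simp
    qed
    have single: "x i \<noteq> 0 \<or> y i \<noteq> 0" if "i \<in> S" for i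
      using indep_on[of "{i}" i "\<lambda>_. 1"] that by auto
    have pair: "x i * y j \<noteq> x j * y i" if ij: "i \<in> S" "j \<in> S" "i \<noteq> j" for i j
    proof
      assume det: "x i * y j = x j * y i"
      \<comment> \<open>If the determinant vanishes, the coefficients \<open>y j\<close>,
        \<open>- y i\<close> form a dependence, and so do \<open>x j\<close>, \<open>- x i\<close>.
        Both must be trivial, which makes the vector at \<open>j\<close> zero.\<close>
      have "y j = 0"
        using indep_on[of "{i, j}" i "\<lambda>k. if k = i then y j else - y i"] ij det
        by (simp add: mult.commute)
      moreover have "x j = 0"
        using indep_on[of "{i, j}" i "\<lambda>k. if k = i then x j else - x i"] ij det
        by (simp add: mult.commute)
      ultimately show False
        using single[OF \<open>j \<in> S\<close>] by simp
    qed
    have "card S \<le> 2"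
    proof (rule ccontr)
      assume "\<not> card S \<le> 2"
      then obtain A where "A \<subseteq> S" "card A = 3"
        using obtain_subset_with_card_n[of 3 S] by auto
      then obtain i j k where A: "A = {i, j, k}" "i \<noteq> j" "j \<noteq> k" "i \<noteq> k"
        by (auto simp: card_3_iff)
      \<comment> \<open>Any three planar vectors satisfy this dependence: the coefficient of each is
        the determinant of the other two, taken in cyclic order. The one at \<open>i\<close> is
        nonzero by \<open>pair\<close>.\<close>
      define g where "g = (\<lambda>l. if l = i then x j * y k - x k * y j
        else if l = j then x k * y i - x i * y k else x i * y j - x j * y i)"
      have "g i = 0"
        by (rule indep_on[OF \<open>A \<subseteq> S\<close>]) (use A in \<open>simp_all add: g_def algebra_simps\<close>)
      then show False
        using pair[of j k] A \<open>A \<subseteq> S\<close> by (simp add: g_def)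
    qed
    then consider "card S = 0" | "card S = 1" | "card S = 2" by linarith
    then show ?thesis
    proof cases
      case 1
      then have "S = {}" using \<open>finite S\<close> by simp
      then show ?thesis
        using span sum_S abs_S
        by (intro bexI[of _ i0] bexI[of _ j0] exI[of _ 0]) auto
    next
      case 2
      then obtain i where i: "S = {i}" by (auto simp: card_1_singleton_iff)
      \<comment> \<open>If the vectors at \<open>i0\<close> and \<open>j0\<close> were both parallel
        to the one at \<open>i\<close>, their determinant times either coordinate of the latter
        would vanish, although that vector is nonzero by \<open>single\<close>. The partner
        \<open>j\<close> found here receives weight zero.\<close>
      have "\<exists>j\<in>I. x i * y j \<noteq> x j * y i"
      proof (rule ccontr)
        assume "\<not> ?thesis"
        then have eqs: "x i * y i0 = x i0 * y i" "x i * y j0 = x j0 * y i"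
          using span by auto
        have "x i * (x i0 * y j0 - x j0 * y i0) = x i0 * (x i * y j0) - x j0 * (x i * y i0)"
          by (simp add: algebra_simps)
        also have "\<dots> = 0"
          unfolding eqs by simp
        finally have "x i * (x i0 * y j0 - x j0 * y i0) = 0" .
        moreover have "y i * (x i0 * y j0 - x j0 * y i0) = (x i0 * y i) * y j0 - (x j0 * y i) * y i0"
          by (simp add: algebra_simps)
        then have "y i * (x i0 * y j0 - x j0 * y i0) = 0"
          unfolding eqs[symmetric] by simp
        ultimately show False
          using span single[of i] i by auto
      qed
      then obtain j where "j \<in> I" "x i * y j \<noteq> x j * y i" by blast
      then show ?thesis
        using i sum_S abs_S \<open>S \<subseteq> I\<close>
        by (intro bexI[of _ i] bexI[of _ j] exI[of _ "w i"] exI[of _ 0]) auto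
    next
      case 3
      then obtain i j where ij: "S = {i, j}" "i \<noteq> j" by (auto simp: card_2_iff)
      then show ?thesis
        using pair[of i j] sum_S abs_S \<open>S \<subseteq> I\<close>
        by (intro bexI[of _ i] bexI[of _ j] exI[of _ "w i"] exI[of _ "w j"]) auto
    qed
  qed
qed

section \<open>Rank two through minors\<close>

text \<open>If all minors vanish, the entries factor as \<open>f r * g c\<close> and the rank is at
  most one. Conversely, a nonzero minor makes the two columns independent by Cramer's rule.\<close>

lemma rank_two_columns_iff:
  fixes A :: "real mat"
  assumes A: "A \<in> carrier_mat n 2"
  shows "vec_space.rank n A = 2 \<longleftrightarrow>
    (\<exists>i<n. \<exists>j<n. A $$ (i, 0) * A $$ (j, 1) \<noteq> A $$ (j, 0) * A $$ (i, 1))"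
proof
  assume rank: "vec_space.rank n A = 2"
  show "\<exists>i<n. \<exists>j<n. A $$ (i, 0) * A $$ (j, 1) \<noteq> A $$ (j, 0) * A $$ (i, 1)"
  proof (rule ccontr)
    assume "\<not> ?thesis"
    then have par: "\<And>i j. i < n \<Longrightarrow> j < n \<Longrightarrow> A $$ (i, 0) * A $$ (j, 1) = A $$ (j, 0) * A $$ (i, 1)"
      by blast
    \<comment> \<open>A row with nonzero first entry has every row as a multiple; if there is none,
      the first column is zero and the second one alone gives the factorization.\<close>
    have "\<exists>f g. \<forall>r<n. \<forall>c<2. A $$ (r, c) = f r * g c"
    proof (cases "\<exists>i<n. A $$ (i, 0) \<noteq> 0")
      case True
      then obtain i where i: "i < n" "A $$ (i, 0) \<noteq> 0" by blast
      have eq: "A $$ (r, c) = A $$ (r, 0) / A $$ (i, 0) * A $$ (i, c)" if "r < n" "c < 2" for r c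
      proof (cases "c = 0")
        case True
        then show ?thesis using i by simp
      next
        case False
        then have c: "c = 1" using \<open>c < 2\<close> by simp
        have "A $$ (r, 1) = A $$ (i, 0) * A $$ (r, 1) / A $$ (i, 0)"
          using i(2) by simp
        also have "\<dots> = A $$ (r, 0) / A $$ (i, 0) * A $$ (i, 1)"
          unfolding par[OF i(1) \<open>r < n\<close>] by simp
        finally show ?thesis unfolding c .
      qed
      show ?thesis
        by (rule exI[of _ "\<lambda>r. A $$ (r, 0) / A $$ (i, 0)"], rule exI[of _ "\<lambda>c. A $$ (i, c)"])
           (intro allI impI eq)
    next
      case False
      then have eq: "A $$ (r, c) = A $$ (r, 1) * (if c = 0 then 0 else 1)" if "r < n" "c < 2" for r c
        using that by (auto simp: less_2_cases_iff)
      show ?thesis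
        by (rule exI[of _ "\<lambda>r. A $$ (r, 1)"], rule exI[of _ "\<lambda>c. if c = 0 then 0 else 1"])
           (intro allI impI eq)
    qed
    then obtain f g where "\<And>r c. r < n \<Longrightarrow> c < 2 \<Longrightarrow> A $$ (r, c) = f r * g c" by blast
    then have "vec_space.rank n A \<le> 1"
      using A by (intro vec_space.rank_le_1_product_entries[where f = f and g = g]) auto
    with rank show False by simp
  qed
next
  assume "\<exists>i<n. \<exists>j<n. A $$ (i, 0) * A $$ (j, 1) \<noteq> A $$ (j, 0) * A $$ (i, 1)"
  then obtain i j where ij: "i < n" "j < n" "A $$ (i, 0) * A $$ (j, 1) \<noteq> A $$ (j, 0) * A $$ (i, 1)"
    by blast
  interpret vec_space "TYPE(real)" n .
  \<comment> \<open>Linear dependence is stated for the set of columns, in which equal columns would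
    collapse into one.\<close>
  have "col A 0 \<noteq> col A 1"
  proof
    assume eq: "col A 0 = col A 1"
    have "A $$ (k, 0) = A $$ (k, 1)" if "k < n" for k
      using arg_cong[OF eq, of "\<lambda>u. u $ k"] that A by simp
    with ij show False by simp
  qed
  then have dist: "distinct (cols A)"
    using A by (simp add: cols_def upt_rec numeral_2_eq_2)
  have "lin_indpt (set (cols A))"
  proof
    assume "lin_dep (set (cols A))"
    then obtain v where v: "v \<in> carrier_vec 2" "v \<noteq> 0\<^sub>v 2" "A *\<^sub>v v = 0\<^sub>v n"
      using lin_depE[OF A _ dist] by blast
    have row: "A $$ (k, 0) * v $ 0 + A $$ (k, 1) * v $ 1 = 0" if "k < n" for k
      using arg_cong[OF v(3), of "\<lambda>u. u $ k"] that A v(1)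
      by (simp add: scalar_prod_def numeral_2_eq_2)
    let ?det = "A $$ (i, 0) * A $$ (j, 1) - A $$ (j, 0) * A $$ (i, 1)"
    let ?row = "\<lambda>k. A $$ (k, 0) * v $ 0 + A $$ (k, 1) * v $ 1"
    \<comment> \<open>Cramer's rule: eliminating one unknown from rows \<open>i\<close> and
      \<open>j\<close> leaves the other times the minor.\<close>
    have "v $ 0 * ?det = A $$ (j, 1) * ?row i - A $$ (i, 1) * ?row j"
      "v $ 1 * ?det = A $$ (i, 0) * ?row j - A $$ (j, 0) * ?row i"
      by (simp_all add: algebra_simps)
    then have "v $ 0 * ?det = 0" "v $ 1 * ?det = 0"
      unfolding row[OF ij(1)] row[OF ij(2)] by simp_all
    then have "v $ 0 = 0" "v $ 1 = 0" using ij by auto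
    then have "v = 0\<^sub>v 2"
      using v(1) by (intro eq_vecI) (auto simp: less_2_cases_iff)
    with v show False by simp
  qed
  then show "rank A = 2"
    by (rule lin_indpt_full_rank[OF A dist])
qed

section \<open>Feasible points and their transfer between problem sizes\<close>

context
  fixes m :: market and \<D> :: "claim set" and t s1 s2 :: real
begin

text \<open>With \<open>load2\<close> this gives the row of the variance matrix as a function of the
  claim alone, so selecting or repeating claims in the list selects or repeats rows.\<close>

definition load1 :: "claim \<Rightarrow> real" where
  "load1 F = deriv (\<lambda>x. F t x s2) s1 * (s1 * vol1 m / F t s1 s2)"

definition load2 :: "claim \<Rightarrow> real" where
  "load2 F = deriv (\<lambda>x. F t s1 x) s2 * (s2 * vol2 m / F t s1 s2)"

lemma variance_matrix_carrier: "variance_matrix m t s1 s2 Os \<in> carrier_mat (length Os) 2"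
  by (simp add: variance_matrix_def mat_of_rows_list_def)

lemma variance_matrix_index:
  assumes "i < length Os"
  shows "variance_matrix m t s1 s2 Os $$ (i, 0) = load1 (Os ! i)"
    and "variance_matrix m t s1 s2 Os $$ (i, 1) = load2 (Os ! i)"
  using assms by (simp_all add: variance_matrix_def mat_of_rows_list_def load1_def load2_def)

text \<open>This puts feasibility into the determinants and weighted sums of
  \<open>planar_basic_solution\<close>. Membership of \<open>optimal_exposure m\<close> in
  \<open>carrier_vec 2\<close> is a conjunct because the coordinate equations yield the vector
  equation only together with the dimension.\<close>

lemma feasible_iff:
  "feasible m \<D> t s1 s2 n (Os, \<pi>) \<longleftrightarrow>
    length Os = n \<and> set Os \<subseteq> \<D> \<and>
    (\<forall>F\<in>set Os. has_partials F t s1 s2 \<and> F t s1 s2 \<noteq> 0) \<and>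
    (\<exists>i<n. \<exists>j<n. load1 (Os ! i) * load2 (Os ! j) \<noteq> load1 (Os ! j) * load2 (Os ! i)) \<and>
    \<pi> \<in> carrier_vec n \<and> optimal_exposure m \<in> carrier_vec 2 \<and>
    (\<Sum>i<n. \<pi> $ i * load1 (Os ! i)) = optimal_exposure m $ 0 \<and>
    (\<Sum>i<n. \<pi> $ i * load2 (Os ! i)) = optimal_exposure m $ 1"
proof (cases "length Os = n \<and> \<pi> \<in> carrier_vec n")
  case True
  then have len: "length Os = n" and \<pi>: "\<pi> \<in> carrier_vec n" by auto
  define A where "A = variance_matrix m t s1 s2 Os"
  have A: "A \<in> carrier_mat n 2"
    using variance_matrix_carrier[of Os] len by (simp add: A_def)
  have entries: "A $$ (i, 0) = load1 (Os ! i)" "A $$ (i, 1) = load2 (Os ! i)" if "i < n" for i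
    using variance_matrix_index[of i Os] that len by (simp_all add: A_def)
  have rank: "vec_space.rank n A = 2 \<longleftrightarrow>
    (\<exists>i<n. \<exists>j<n. load1 (Os ! i) * load2 (Os ! j) \<noteq> load1 (Os ! j) * load2 (Os ! i))"
    unfolding rank_two_columns_iff[OF A] by (simp add: entries del: One_nat_def cong: conj_cong)
  have carrier: "transpose_mat A *\<^sub>v \<pi> \<in> carrier_vec 2"
    using A by (metis carrier_vecI dim_mult_mat_vec index_transpose_mat(2) carrier_matD(2))
  have "(transpose_mat A *\<^sub>v \<pi>) $ 0 = (\<Sum>i<n. \<pi> $ i * load1 (Os ! i))"
    "(transpose_mat A *\<^sub>v \<pi>) $ 1 = (\<Sum>i<n. \<pi> $ i * load2 (Os ! i))"
    using A \<pi> entries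
    by (auto simp: scalar_prod_def atLeast0LessThan mult.commute intro!: sum.cong)
  then have "transpose_mat A *\<^sub>v \<pi> = optimal_exposure m \<longleftrightarrow>
      optimal_exposure m \<in> carrier_vec 2 \<and>
      (\<Sum>i<n. \<pi> $ i * load1 (Os ! i)) = optimal_exposure m $ 0 \<and>
      (\<Sum>i<n. \<pi> $ i * load2 (Os ! i)) = optimal_exposure m $ 1"
    using carrier by (metis carrier_vecD eq_vecI less_2_cases_iff One_nat_def)
  then show ?thesis
    using len \<pi> rank
    by (auto simp: feasible_def derivative_vectors_def eu_maximizing_def A_def)
next
  case False
  then show ?thesis
    by (auto simp: feasible_def derivative_vectors_def eu_maximizing_def)
qed

text \<open>The two claims selected by \<open>planar_basic_solution\<close> come from
  \<open>Os\<close> and so inherit admissibility; their nonzero determinant is the rank condition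
  for two derivatives.\<close>

lemma feasible_reduce:
  assumes "feasible m \<D> t s1 s2 n (Os, \<pi>)"
  shows "\<exists>Os' \<pi>'. feasible m \<D> t s1 s2 2 (Os', \<pi>') \<and> l1_norm \<pi>' \<le> l1_norm \<pi>"
proof -
  note feas = assms[unfolded feasible_iff]
  obtain i0 j0 where "i0 < n" "j0 < n"
    "load1 (Os ! i0) * load2 (Os ! j0) \<noteq> load1 (Os ! j0) * load2 (Os ! i0)"
    using feas by blast
  then obtain i j a b where ij: "i < n" "j < n"
    "load1 (Os ! i) * load2 (Os ! j) \<noteq> load1 (Os ! j) * load2 (Os ! i)"
    "a * load1 (Os ! i) + b * load1 (Os ! j) = optimal_exposure m $ 0"
    "a * load2 (Os ! i) + b * load2 (Os ! j) = optimal_exposure m $ 1"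
    "\<bar>a\<bar> + \<bar>b\<bar> \<le> l1_norm \<pi>"
    using planar_basic_solution[of "{..<n}" i0 j0 "\<lambda>i. load1 (Os ! i)" "\<lambda>i. load2 (Os ! i)" "($) \<pi>"]
      feas by (auto simp: l1_norm_def)
  let ?Os = "[Os ! i, Os ! j]" and ?\<pi> = "vec_of_list [a, b]"
  have "set ?Os \<subseteq> set Os"
    using ij feas by auto
  moreover have "\<exists>i<2. \<exists>j<2. load1 (?Os ! i) * load2 (?Os ! j) \<noteq> load1 (?Os ! j) * load2 (?Os ! i)"
    using ij(3) by (intro exI[of _ 0] conjI exI[of _ 1]) simp_all
  moreover have "(\<Sum>k<2. ?\<pi> $ k * f (?Os ! k)) = a * f (Os ! i) + b * f (Os ! j)" for f
    by (simp add: numeral_2_eq_2)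
  moreover have "?\<pi> \<in> carrier_vec 2"
    by (rule carrier_vecI) simp
  ultimately have "feasible m \<D> t s1 s2 2 (?Os, ?\<pi>)"
    unfolding feasible_iff using ij(4,5) feas by (simp add: subset_iff)
  moreover have "l1_norm (vec_of_list [a, b]) = \<bar>a\<bar> + \<bar>b\<bar>"
    by (simp add: l1_norm_def numeral_2_eq_2)
  ultimately show ?thesis
    using ij by metis
qed

text \<open>Entries of a derivative vector may coincide, so repeating the first claim is admissible.
  The original two rows keep their nonzero minor, and the zero weights leave exposure and norm
  unchanged.\<close>

lemma feasible_pad:
  assumes "feasible m \<D> t s1 s2 2 (Os, \<pi>)" and "2 \<le> n"
  shows "\<exists>Os' \<pi>'. feasible m \<D> t s1 s2 n (Os', \<pi>') \<and> l1_norm \<pi>' = l1_norm \<pi> \<and>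
    {i. i < n \<and> \<pi>' $ i \<noteq> 0} \<subseteq> {..<2}"
proof -
  note feas = assms(1)[unfolded feasible_iff]
  define Os' where "Os' = Os @ replicate (n - 2) (hd Os)"
  define \<pi>' where "\<pi>' = vec n (\<lambda>i. if i < 2 then \<pi> $ i else 0)"
  have len: "length Os = 2" using feas by blast
  \<comment> \<open>The function \<open>g\<close> is generic so that one argument serves both
    exposure sums and the l1 norm.\<close>
  have sums: "(\<Sum>i<n. g (\<pi>' $ i) (Os' ! i)) = (\<Sum>i<2. g (\<pi> $ i) (Os ! i))"
    if "\<And>F. g 0 F = 0" for g :: "real \<Rightarrow> claim \<Rightarrow> real"
  proof -
    have "(\<Sum>i<n. g (\<pi>' $ i) (Os' ! i)) = (\<Sum>i<2. g (\<pi>' $ i) (Os' ! i))"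
      using \<open>2 \<le> n\<close> that by (intro sum.mono_neutral_right) (auto simp: \<pi>'_def)
    then show ?thesis
      using \<open>2 \<le> n\<close> len by (auto simp: \<pi>'_def Os'_def nth_append intro!: sum.cong)
  qed
  have "set Os' = set Os"
    using len by (cases Os) (auto simp: Os'_def)
  moreover have "length Os' = n"
    using len \<open>2 \<le> n\<close> by (simp add: Os'_def)
  moreover have "\<exists>i<n. \<exists>j<n. load1 (Os' ! i) * load2 (Os' ! j) \<noteq> load1 (Os' ! j) * load2 (Os' ! i)"
  proof -
    obtain i j where "i < 2" "j < 2" "load1 (Os ! i) * load2 (Os ! j) \<noteq> load1 (Os ! j) * load2 (Os ! i)"
      using feas by blast
    then show ?thesis
      using \<open>2 \<le> n\<close> len by (intro exI[of _ i] conjI exI[of _ j]) (auto simp: Os'_def nth_append)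
  qed
  ultimately have "feasible m \<D> t s1 s2 n (Os', \<pi>')"
    unfolding feasible_iff
    using feas sums[of "\<lambda>p F. p * load1 F"] sums[of "\<lambda>p F. p * load2 F"]
    by (auto simp: \<pi>'_def)
  moreover have "l1_norm \<pi>' = l1_norm \<pi>"
    using sums[of "\<lambda>p F. \<bar>p\<bar>"] feas by (auto simp: l1_norm_def \<pi>'_def)
  moreover have "{i. i < n \<and> \<pi>' $ i \<noteq> 0} \<subseteq> {..<2}"
    by (auto simp: \<pi>'_def split: if_splits)
  ultimately show ?thesis by blast
qed

lemma optimal_iff:
  "optimal m \<D> t s1 s2 n (Os, \<pi>) \<longleftrightarrow> feasible m \<D> t s1 s2 n (Os, \<pi>) \<and>
    (\<forall>Os' \<pi>'. feasible m \<D> t s1 s2 n (Os', \<pi>') \<longrightarrow> l1_norm \<pi> \<le> l1_norm \<pi>')"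
  by (auto simp: optimal_def is_arg_min_linorder)

text \<open>Passing through two derivatives allows \<open>k\<close> and \<open>n\<close> in either
  order, and the padding step leaves at most two nonzero weights.\<close>

lemma feasible_transfer:
  assumes "feasible m \<D> t s1 s2 k (Os, \<pi>)" and "2 \<le> n"
  shows "\<exists>Os' \<pi>'. feasible m \<D> t s1 s2 n (Os', \<pi>') \<and> l1_norm \<pi>' \<le> l1_norm \<pi> \<and>
    card {i. i < n \<and> \<pi>' $ i \<noteq> 0} \<le> 2"
proof -
  obtain Os2 \<pi>2 where two: "feasible m \<D> t s1 s2 2 (Os2, \<pi>2)" "l1_norm \<pi>2 \<le> l1_norm \<pi>"
    using feasible_reduce[OF assms(1)] by blast
  obtain Os' \<pi>' where "feasible m \<D> t s1 s2 n (Os', \<pi>')" "l1_norm \<pi>' = l1_norm \<pi>2"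
    "{i. i < n \<and> \<pi>' $ i \<noteq> 0} \<subseteq> {..<2}"
    using feasible_pad[OF two(1) assms(2)] by blast
  moreover from this(3) have "card {i. i < n \<and> \<pi>' $ i \<noteq> 0} \<le> 2"
    using card_mono[of "{..<2::nat}"] by simp
  ultimately show ?thesis
    using two(2) by auto
qed

end

theorem proposition2:
  fixes m :: market and \<D> :: "claim set" and T t s1 s2 :: real
  assumes "vol1 m > 0" and "vol2 m > 0"
    and "-1 < corr m" and "corr m < 1"
    and "risk_aversion m > 0" and "risk_aversion m \<noteq> 1"
    and "infinite \<D>"
    and "0 \<le> t" and "t \<le> T"
    and "s1 > 0" and "s2 > 0"
    and "\<forall>n\<ge>2. \<exists>Os \<pi>. optimal m \<D> t s1 s2 n (Os, \<pi>)"
  shows "(\<forall>n\<ge>2. \<forall>k\<ge>2. \<forall>Os \<pi> Os' \<pi>'.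
            optimal m \<D> t s1 s2 n (Os, \<pi>) \<longrightarrow> optimal m \<D> t s1 s2 k (Os', \<pi>') \<longrightarrow>
            l1_norm \<pi> = l1_norm \<pi>') \<and>
         (\<forall>n\<ge>2. \<exists>Os \<pi>. optimal m \<D> t s1 s2 n (Os, \<pi>) \<and>
            card {i. i < n \<and> vec_index \<pi> i \<noteq> 0} \<le> 2)"
proof (intro conjI allI impI)
  \<comment> \<open>An optimum for \<open>k\<close> transfers to a competitor for \<open>n\<close>
    of no larger norm; exchanging the roles of \<open>n\<close> and \<open>k\<close> then gives
    equality.\<close>
  have le: "l1_norm \<pi> \<le> l1_norm \<pi>'"
    if "2 \<le> n" "optimal m \<D> t s1 s2 n (Os, \<pi>)" "optimal m \<D> t s1 s2 k (Os', \<pi>')"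
    for n k :: nat and Os Os' \<pi> \<pi>'
    using feasible_transfer[of m \<D> t s1 s2 k Os' \<pi>' n] that unfolding optimal_iff
    by (meson order_trans)
  show "l1_norm \<pi> = l1_norm \<pi>'"
    if "2 \<le> n" "2 \<le> k" "optimal m \<D> t s1 s2 n (Os, \<pi>)" "optimal m \<D> t s1 s2 k (Os', \<pi>')"
    for n k :: nat and Os Os' \<pi> \<pi>'
    using le that by (meson order_antisym)
next
  fix n :: nat
  assume n: "2 \<le> n"
  then obtain Os \<pi> where opt: "optimal m \<D> t s1 s2 n (Os, \<pi>)"
    using assms(12) by blast
  \<comment> \<open>Transfer from \<open>n\<close> to \<open>n\<close> itself makes the optimum
    sparse; since its norm does not grow, it stays optimal.\<close>
  then obtain Os' \<pi>' where "feasible m \<D> t s1 s2 n (Os', \<pi>')" "l1_norm \<pi>' \<le> l1_norm \<pi>"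
    "card {i. i < n \<and> \<pi>' $ i \<noteq> 0} \<le> 2"
    using feasible_transfer[OF _ n] unfolding optimal_iff by meson
  then show "\<exists>Os \<pi>. optimal m \<D> t s1 s2 n (Os, \<pi>) \<and> card {i. i < n \<and> vec_index \<pi> i \<noteq> 0} \<le> 2"
    using opt unfolding optimal_iff by (meson order_trans)
qed

end
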